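(* Let $(H,\langle\cdot,\cdot\rangle_H)$ be a Hilbert space and suppose that $F\colon[0,+\infty)\to[0,+\infty)$ is a function such that $F(0)=0$ and $$\sup_{x>0}\frac{F(x)}{x}<+\infty.$$ If $p\in[1,+\infty]$ is an extended real number and $$\sup\{c_H(A):A\subset F[\ell_p],\ A\text{ finite}\}\leq2^{\varepsilon},\quad\text{where }\varepsilon\in\left[0,\tfrac12\right),$$ then $p\leq\left(\frac12-\varepsilon\right)^{-1}$.
   Context: A quasi-metric space $(X,\rho_X)$ is a set $X$ with a function $\rho_X\colon X\times X\to\mathbb{R}$ that is non-negative, symmetric and vanishes on the diagonal. For a map $f\colon X\to Y$ between quasi-metric spaces, $\operatorname{Lip}(f):=\inf\{L\geq0:\rho_Y(f(x),f(x'))\leq L\,\rho_X(x,x')\text{ for all }x,x'\in X\}$, with the convention $\inf\varnothing=+\infty$. For an injective map $f\colon X\to Y$, $\operatorname{dist}(f):=\operatorname{Lip}(f)\operatorname{Lip}(f^{-1})$, where $f^{-1}$ is defined on $f(X)$. Put $$c_Y(X):=\inf\{\operatorname{dist}(f):f\colon X\to Y\text{ injective}\}.$$ For a function $F\colon[0,+\infty)\to[0,+\infty)$ with $F(0)=0$, the $F$-transform $F[Y]$ of a quasi-metric space $(Y,\rho_Y)$ is the quasi-metric space $(Y,F\circ\rho_Y)$; thus $F[\ell_p]$ is $\ell_p$ equipped with $(x,y)\mapsto F(\|x-y\|_p)$, and subsets $A\subset F[\ell_p]$ carry the restricted quasi-metric. $H$ carries the metric induced by its norm. *)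

theory Defs
  imports "HOL-Analysis.Analysis"
begin

text \<open>
  A quasi-metric space is represented by a carrier set together with a real-valued
  function on pairs of points, only the values on the carrier being relevant.
\<close>

definition quasi_metric_on :: "'a set \<Rightarrow> ('a \<Rightarrow> 'a \<Rightarrow> real) \<Rightarrow> bool" where
  "quasi_metric_on X \<rho> \<longleftrightarrow>
     (\<forall>x\<in>X. \<forall>y\<in>X. 0 \<le> \<rho> x y) \<and>
     (\<forall>x\<in>X. \<forall>y\<in>X. \<rho> x y = \<rho> y x) \<and>
     (\<forall>x\<in>X. \<rho> x x = 0)"

text \<open>The infimum is taken in the extended reals, so it is \<open>\<infinity>\<close> for the empty set.\<close>

definition Lip ::
  "'a set \<Rightarrow> ('a \<Rightarrow> 'a \<Rightarrow> real) \<Rightarrow> ('b \<Rightarrow> 'b \<Rightarrow> real) \<Rightarrow> ('a \<Rightarrow> 'b) \<Rightarrow> ereal" where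
  "Lip X \<rho>X \<rho>Y f =
     Inf {ereal L | L. 0 \<le> L \<and> (\<forall>x\<in>X. \<forall>x'\<in>X. \<rho>Y (f x) (f x') \<le> L * \<rho>X x x')}"

text \<open>
  The distortion is the product of the two Lipschitz constants, with the convention that
  it is infinite as soon as one of the factors is. This differs from the product of
  the extended reals only for \<open>0 * \<infinity>\<close>, which the library evaluates to \<open>0\<close>: otherwise an
  injection of a space with vanishing quasi-metric and at least two points into a
  metric space, which is not Lipschitz, would have distortion \<open>0\<close>.
\<close>

definition distortion ::
  "'a set \<Rightarrow> ('a \<Rightarrow> 'a \<Rightarrow> real) \<Rightarrow> ('b \<Rightarrow> 'b \<Rightarrow> real) \<Rightarrow> ('a \<Rightarrow> 'b) \<Rightarrow> ereal" where
  "distortion X \<rho>X \<rho>Y f =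
     (let l = Lip X \<rho>X \<rho>Y f; l' = Lip (f ` X) \<rho>Y \<rho>X (inv_into X f)
      in if l = \<infinity> \<or> l' = \<infinity> then \<infinity> else l * l')"

definition least_distortion ::
  "'b set \<Rightarrow> ('b \<Rightarrow> 'b \<Rightarrow> real) \<Rightarrow> 'a set \<Rightarrow> ('a \<Rightarrow> 'a \<Rightarrow> real) \<Rightarrow> ereal" where
  "least_distortion Y \<rho>Y X \<rho>X =
     Inf {distortion X \<rho>X \<rho>Y f | f. f \<in> X \<rightarrow> Y \<and> inj_on f X}"

definition F_transform :: "(real \<Rightarrow> real) \<Rightarrow> ('a \<Rightarrow> 'a \<Rightarrow> real) \<Rightarrow> 'a \<Rightarrow> 'a \<Rightarrow> real" where
  "F_transform F \<rho> x y = F (\<rho> x y)"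

definition lp_space :: "ereal \<Rightarrow> (nat \<Rightarrow> real) set" where
  "lp_space p =
     (if p = \<infinity> then {x. bdd_above (range (\<lambda>n. \<bar>x n\<bar>))}
      else {x. summable (\<lambda>n. \<bar>x n\<bar> powr real_of_ereal p)})"

definition lp_norm :: "ereal \<Rightarrow> (nat \<Rightarrow> real) \<Rightarrow> real" where
  "lp_norm p x =
     (if p = \<infinity> then (SUP n. \<bar>x n\<bar>)
      else (\<Sum>n. \<bar>x n\<bar> powr real_of_ereal p) powr (1 / real_of_ereal p))"

definition lp_dist :: "ereal \<Rightarrow> (nat \<Rightarrow> real) \<Rightarrow> (nat \<Rightarrow> real) \<Rightarrow> real" where
  "lp_dist p x y = lp_norm p (\<lambda>n. x n - y n)"

lemma quasi_metric_on_lp: "quasi_metric_on (lp_space p) (lp_dist p)"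
proof -
  have nonneg: "0 \<le> lp_dist p x y" if "x \<in> lp_space p" "y \<in> lp_space p" for x y
  proof (cases "p = \<infinity>")
    case True
    from that obtain a b where ab: "\<And>n. \<bar>x n\<bar> \<le> a" "\<And>n. \<bar>y n\<bar> \<le> b"
      unfolding lp_space_def using True by (auto simp: bdd_above_def)
    have "\<bar>x n - y n\<bar> \<le> a + b" for n
      using ab(1)[of n] ab(2)[of n] by linarith
    then have "bdd_above (range (\<lambda>n. \<bar>x n - y n\<bar>))"
      by (auto simp: bdd_above_def)
    then have "\<bar>x 0 - y 0\<bar> \<le> (SUP n. \<bar>x n - y n\<bar>)"
      by (rule cSUP_upper2[of _ _ 0]) auto
    then have "0 \<le> (SUP n. \<bar>x n - y n\<bar>)"
      by linarith
    then show ?thesis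
      using True by (simp add: lp_dist_def lp_norm_def)
  qed (simp add: lp_dist_def lp_norm_def)
  have "lp_dist p x y = lp_dist p y x" "lp_dist p x x = 0" for x y
    by (simp_all add: lp_dist_def lp_norm_def abs_minus_commute)
  with nonneg show ?thesis
    by (auto simp: quasi_metric_on_def)
qed

lemma quasi_metric_on_F_transform:
  assumes "quasi_metric_on Y \<rho>" "\<And>t. 0 \<le> t \<Longrightarrow> 0 \<le> F t" "F 0 = 0"
  shows "quasi_metric_on Y (F_transform F \<rho>)"
  using assms by (auto simp: quasi_metric_on_def F_transform_def)

end

theory Submission
  imports Defs
begin

text \<open>
  The proof compares the quadrilaterals of a Hilbert space with one quadrilateral of the
  plane spanned by the first two coordinates of \<open>\<ell>\<^sub>p\<close>. In an inner product space the squares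
  of the two diagonals of a quadrilateral add up to at most the squares of its four sides. In
  \<open>\<ell>\<^sub>p\<close> the four points \<open>(0,0)\<close>, \<open>(s,s)\<close>, \<open>(2s,0)\<close>, \<open>(s,-s)\<close> have sides of length
  \<open>2 powr (1/p) * s\<close> and diagonals of length \<open>2s\<close>. Embedding them with distortion \<open>D\<close> after
  the transform \<open>F\<close> therefore forces \<open>F (2s) \<le> sqrt 2 * D * F (2 powr (1/p) * s)\<close>, and
  letting \<open>D\<close> tend to \<open>2 powr \<epsilon>\<close> gives, after rescaling,
  \<open>F (2 powr (1 - 1/p) * t) \<le> 2 powr (1/2 + \<epsilon>) * F t\<close> for all \<open>t > 0\<close>.

  Read from right to left, this says that \<open>F\<close> cannot decay too fast towards \<open>0\<close>: a division of
  the argument by \<open>2 powr (1 - 1/p)\<close> costs at most a factor \<open>2 powr (1/2 + \<epsilon>)\<close>. But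
  \<open>F x \<le> C * x\<close>, so \<open>F\<close> does decay at least linearly. Iterating, the two are compatible
  only if \<open>1 - 1/p \<le> 1/2 + \<epsilon>\<close>, which is the claim. The iteration starts from a point where
  \<open>F\<close> is positive; \<open>F\<close> is positive on all of \<open>(0,\<infinity>)\<close> because points at transformed distance
  zero cannot be separated by a map with a finite Lipschitz constant.
\<close>

text \<open>
  A Lipschitz constant is attained: for a pair at positive distance it is bounded below by the
  quotient of the distances, and for a pair at distance zero any admissible constant will do.
\<close>

lemma Lip_attained:
  assumes nonneg: "\<And>x y. x \<in> X \<Longrightarrow> y \<in> X \<Longrightarrow> 0 \<le> \<rho>X x y"
    and finite: "Lip X \<rho>X \<rho>Y f \<noteq> \<infinity>"
  obtains l where "Lip X \<rho>X \<rho>Y f = ereal l" "0 \<le> l"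
    "\<And>x y. x \<in> X \<Longrightarrow> y \<in> X \<Longrightarrow> \<rho>Y (f x) (f y) \<le> l * \<rho>X x y"
proof -
  define S where
    "S = {ereal L | L. 0 \<le> L \<and> (\<forall>x\<in>X. \<forall>x'\<in>X. \<rho>Y (f x) (f x') \<le> L * \<rho>X x x')}"
  have Lip: "Lip X \<rho>X \<rho>Y f = Inf S"
    by (simp add: Lip_def S_def)
  have "S \<noteq> {}"
    using finite by (auto simp: Lip top_ereal_def)
  then obtain L where L: "\<And>x y. x \<in> X \<Longrightarrow> y \<in> X \<Longrightarrow> \<rho>Y (f x) (f y) \<le> L * \<rho>X x y"
    by (auto simp: S_def)
  have "0 \<le> Inf S"
    by (rule Inf_greatest) (auto simp: S_def)
  with finite Lip obtain l where l: "Inf S = ereal l" "0 \<le> l"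
    by (cases "Inf S") auto
  have "\<rho>Y (f x) (f y) \<le> l * \<rho>X x y" if xy: "x \<in> X" "y \<in> X" for x y
  proof (cases "\<rho>X x y = 0")
    case True
    with L[OF xy] show ?thesis
      by simp
  next
    case False
    with nonneg[OF xy] have pos: "0 < \<rho>X x y"
      by simp
    have "ereal (\<rho>Y (f x) (f y) / \<rho>X x y) \<le> Inf S"
      by (rule Inf_greatest) (use xy pos in \<open>auto simp: S_def pos_divide_le_eq\<close>)
    with l pos show ?thesis
      by (simp add: pos_divide_le_eq)
  qed
  with l Lip that show ?thesis
    by metis
qed

lemma least_distortion_lessE:
  assumes X: "quasi_metric_on X \<rho>X" and Y: "quasi_metric_on Y \<rho>Y"
    and less: "least_distortion Y \<rho>Y X \<rho>X < ereal D"
  obtains f l l' where "inj_on f X" "f \<in> X \<rightarrow> Y" "0 \<le> l" "0 \<le> l'" "l * l' < D"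
    "\<And>x y. x \<in> X \<Longrightarrow> y \<in> X \<Longrightarrow> \<rho>Y (f x) (f y) \<le> l * \<rho>X x y"
    "\<And>x y. x \<in> X \<Longrightarrow> y \<in> X \<Longrightarrow> \<rho>X x y \<le> l' * \<rho>Y (f x) (f y)"
proof -
  from less obtain f where f: "f \<in> X \<rightarrow> Y" "inj_on f X"
    and dist: "distortion X \<rho>X \<rho>Y f < ereal D"
    by (auto simp: least_distortion_def Inf_less_iff)
  let ?g = "inv_into X f"
  have fin: "Lip X \<rho>X \<rho>Y f \<noteq> \<infinity>" "Lip (f ` X) \<rho>Y \<rho>X ?g \<noteq> \<infinity>"
    using dist by (auto simp: distortion_def Let_def split: if_splits)
  obtain l where l: "Lip X \<rho>X \<rho>Y f = ereal l" "0 \<le> l"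
    "\<And>x y. x \<in> X \<Longrightarrow> y \<in> X \<Longrightarrow> \<rho>Y (f x) (f y) \<le> l * \<rho>X x y"
    by (rule Lip_attained[OF _ fin(1)]) (use X in \<open>auto simp: quasi_metric_on_def\<close>)
  obtain l' where l': "Lip (f ` X) \<rho>Y \<rho>X ?g = ereal l'" "0 \<le> l'"
    "\<And>x y. x \<in> f ` X \<Longrightarrow> y \<in> f ` X \<Longrightarrow> \<rho>X (?g x) (?g y) \<le> l' * \<rho>Y x y"
    by (rule Lip_attained[OF _ fin(2)]) (use Y f(1) in \<open>auto simp: quasi_metric_on_def Pi_iff\<close>)
  have "\<rho>X x y \<le> l' * \<rho>Y (f x) (f y)" if "x \<in> X" "y \<in> X" for x y
    using l'(3)[of "f x" "f y"] that f(2) by simp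
  moreover have "l * l' < D"
    using dist fin l(1) l'(1) by (simp add: distortion_def)
  ultimately show ?thesis
    using that f l(2,3) l'(2) by blast
qed

text \<open>
  The difference of the two sides is the square of the norm of \<open>a - b + c - d\<close>, which
  vanishes exactly for parallelograms.
\<close>

lemma quadrilateral_inequality:
  fixes a b c d :: "'h :: real_inner"
  shows "(dist a c)\<^sup>2 + (dist b d)\<^sup>2
    \<le> (dist a b)\<^sup>2 + (dist b c)\<^sup>2 + (dist c d)\<^sup>2 + (dist d a)\<^sup>2"
proof -
  have "0 \<le> (a - b + c - d) \<bullet> (a - b + c - d)"
    by simp
  then show ?thesis
    by (simp add: dist_norm power2_norm_eq_inner algebra_simps inner_commute)
qed

text \<open>
  Whatever the scales of the embedding and of its inverse, they enter the comparison of
  diagonals and sides only through their product. Positivity of the diagonal comes from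
  injectivity: the image of the diagonal is positive and at most a finite multiple of it.
\<close>

lemma diagonal_le_side:
  fixes \<rho> :: "'a \<Rightarrow> 'a \<Rightarrow> real"
  assumes qm: "quasi_metric_on {a, b, c, d} \<rho>"
    and "a \<noteq> c"
    and sides: "\<rho> a b = \<sigma>" "\<rho> b c = \<sigma>" "\<rho> c d = \<sigma>" "\<rho> d a = \<sigma>"
    and diagonals: "\<rho> a c = \<delta>" "\<rho> b d = \<delta>"
    and K: "least_distortion (UNIV :: 'h :: real_inner set) dist {a, b, c, d} \<rho> \<le> ereal K"
  shows "0 < \<delta>" "\<delta> \<le> sqrt 2 * K * \<sigma>"
proof -
  have UNIV: "quasi_metric_on (UNIV :: 'h set) dist"
    by (simp add: quasi_metric_on_def dist_commute)
  have "0 \<le> \<rho> a b" "0 \<le> \<rho> a c"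
    using qm unfolding quasi_metric_on_def by blast+
  then have nonneg: "0 \<le> \<sigma>" "0 \<le> \<delta>"
    using sides(1) diagonals(1) by simp_all
  have *: "0 < \<delta> \<and> \<delta> \<le> sqrt 2 * D * \<sigma>" if "K < D" for D
  proof -
    have less: "least_distortion (UNIV :: 'h set) dist {a, b, c, d} \<rho> < ereal D"
      using K that by (simp add: le_less_trans)
    obtain f :: "'a \<Rightarrow> 'h" and l l' where inj: "inj_on f {a, b, c, d}"
      and ll': "0 \<le> l" "0 \<le> l'" "l * l' < D"
      and upper: "\<And>x y. x \<in> {a, b, c, d} \<Longrightarrow> y \<in> {a, b, c, d} \<Longrightarrow> dist (f x) (f y) \<le> l * \<rho> x y"
      and lower: "\<And>x y. x \<in> {a, b, c, d} \<Longrightarrow> y \<in> {a, b, c, d} \<Longrightarrow> \<rho> x y \<le> l' * dist (f x) (f y)"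
      by (rule least_distortion_lessE[OF qm UNIV less]) blast
    have "0 < dist (f a) (f c)"
      using inj \<open>a \<noteq> c\<close> by (auto dest: inj_onD)
    also have "\<dots> \<le> l * \<delta>"
      using upper[of a c] diagonals by simp
    finally have "0 < \<delta>"
      using ll' nonneg by (auto simp: zero_less_mult_iff)
    have "(dist (f a) (f b))\<^sup>2 \<le> (l * \<sigma>)\<^sup>2" "(dist (f b) (f c))\<^sup>2 \<le> (l * \<sigma>)\<^sup>2"
      "(dist (f c) (f d))\<^sup>2 \<le> (l * \<sigma>)\<^sup>2" "(dist (f d) (f a))\<^sup>2 \<le> (l * \<sigma>)\<^sup>2"
      using upper[of a b] upper[of b c] upper[of c d] upper[of d a] sides
      by (auto intro!: power_mono)
    then have images: "(dist (f a) (f c))\<^sup>2 + (dist (f b) (f d))\<^sup>2 \<le> 4 * (l * \<sigma>)\<^sup>2"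
      using quadrilateral_inequality[of "f a" "f c" "f b" "f d"] by linarith
    have "\<delta>\<^sup>2 \<le> (l' * dist (f a) (f c))\<^sup>2" "\<delta>\<^sup>2 \<le> (l' * dist (f b) (f d))\<^sup>2"
      using lower[of a c] lower[of b d] diagonals nonneg by (auto intro!: power_mono)
    then have "2 * \<delta>\<^sup>2 \<le> l'\<^sup>2 * ((dist (f a) (f c))\<^sup>2 + (dist (f b) (f d))\<^sup>2)"
      by (simp add: power_mult_distrib distrib_left)
    also have "\<dots> \<le> l'\<^sup>2 * (4 * (l * \<sigma>)\<^sup>2)"
      by (rule mult_left_mono[OF images]) simp
    finally have "\<delta>\<^sup>2 \<le> (sqrt 2 * (l * l') * \<sigma>)\<^sup>2"
      by (simp add: power_mult_distrib mult_ac)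
    then have "\<delta> \<le> sqrt 2 * (l * l') * \<sigma>"
      by (rule power2_le_imp_le) (use ll' nonneg in simp)
    also have "\<dots> \<le> sqrt 2 * D * \<sigma>"
      using ll' nonneg by (intro mult_right_mono mult_left_mono) auto
    finally show ?thesis
      using \<open>0 < \<delta>\<close> by simp
  qed
  show "0 < \<delta>"
    using *[of "K + 1"] by simp
  show "\<delta> \<le> sqrt 2 * K * \<sigma>"
  proof (rule tendsto_lowerbound)
    show "((\<lambda>D. sqrt 2 * D * \<sigma>) \<longlongrightarrow> sqrt 2 * K * \<sigma>) (at_right K)"
      by (intro tendsto_intros)
    show "\<forall>\<^sub>F D in at_right K. \<delta> \<le> sqrt 2 * D * \<sigma>"
      using * by (auto intro: eventually_mono[OF eventually_at_right_less])
  qed simp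
qed

definition plane_point :: "real \<Rightarrow> real \<Rightarrow> nat \<Rightarrow> real" where
  "plane_point u v n = (if n = 0 then u else if n = 1 then v else 0)"

text \<open>With \<open>1 / \<infinity>\<close> read as \<open>0\<close>, one formula for the side length below covers the endpoint \<open>p = \<infinity>\<close>.\<close>

definition recip_exponent :: "ereal \<Rightarrow> real" where
  "recip_exponent p = (if p = \<infinity> then 0 else 1 / real_of_ereal p)"

lemma plane_point_diff:
  "(\<lambda>n. plane_point u v n - plane_point u' v' n) = plane_point (u - u') (v - v')"
  by (auto simp: plane_point_def)

lemma plane_point_powr_sums:
  "(\<lambda>n. \<bar>plane_point u v n\<bar> powr r) sums (\<bar>u\<bar> powr r + \<bar>v\<bar> powr r)"
proof -
  have "(\<lambda>n. \<bar>plane_point u v n\<bar> powr r) sums (\<Sum>n\<in>{0, 1}. \<bar>plane_point u v n\<bar> powr r)"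
    by (rule sums_finite) (auto simp: plane_point_def)
  then show ?thesis
    by (simp add: plane_point_def)
qed

lemma plane_point_in_lp_space: "plane_point u v \<in> lp_space p"
proof -
  have "\<bar>plane_point u v n\<bar> \<le> \<bar>u\<bar> + \<bar>v\<bar>" for n
    by (simp add: plane_point_def)
  then have "bdd_above (range (\<lambda>n. \<bar>plane_point u v n\<bar>))"
    by (auto simp: bdd_above_def)
  then show ?thesis
    using sums_summable[OF plane_point_powr_sums] by (simp add: lp_space_def)
qed

lemma lp_norm_plane_point_infinity: "lp_norm \<infinity> (plane_point u v) = max \<bar>u\<bar> \<bar>v\<bar>"
proof -
  have "range (\<lambda>n. \<bar>plane_point u v n\<bar>) = {\<bar>u\<bar>, \<bar>v\<bar>, 0}"
  proof
    show "{\<bar>u\<bar>, \<bar>v\<bar>, 0} \<subseteq> range (\<lambda>n. \<bar>plane_point u v n\<bar>)"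
      using rangeI[of "\<lambda>n. \<bar>plane_point u v n\<bar>" 0] rangeI[of "\<lambda>n. \<bar>plane_point u v n\<bar>" 1]
        rangeI[of "\<lambda>n. \<bar>plane_point u v n\<bar>" 2]
      by (simp add: plane_point_def)
  qed (auto simp: plane_point_def)
  then show ?thesis
    by (simp add: lp_norm_def cSup_eq_Max)
qed

lemma lp_norm_plane_point_finite:
  "lp_norm (ereal r) (plane_point u v) = (\<bar>u\<bar> powr r + \<bar>v\<bar> powr r) powr (1 / r)"
  by (simp add: lp_norm_def sums_unique[OF plane_point_powr_sums, symmetric])

lemma lp_norm_axis:
  assumes "1 \<le> p"
  shows "lp_norm p (plane_point u 0) = \<bar>u\<bar>" "lp_norm p (plane_point 0 u) = \<bar>u\<bar>"
  using assms
  by (cases p; simp add: lp_norm_plane_point_infinity lp_norm_plane_point_finite powr_powr)+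

lemma lp_norm_bisector:
  assumes "1 \<le> p" "\<bar>u\<bar> = s" "\<bar>v\<bar> = s"
  shows "lp_norm p (plane_point u v) = 2 powr recip_exponent p * s"
proof (cases p)
  case (real r)
  have "(s powr r + s powr r) powr (1 / r) = (2 * s powr r) powr (1 / r)"
    by simp
  also have "\<dots> = 2 powr (1 / r) * s"
    using assms real by (auto simp: powr_mult powr_powr)
  finally show ?thesis
    using assms real by (simp add: lp_norm_plane_point_finite recip_exponent_def)
qed (use assms in \<open>auto simp: lp_norm_plane_point_infinity recip_exponent_def\<close>)

text \<open>
  The quadrilateral with vertices \<open>(0,0)\<close>, \<open>(s,s)\<close>, \<open>(2s,0)\<close>, \<open>(s,-s)\<close> is a square of the
  plane whose diagonals are parallel to the coordinate axes. For \<open>p > 2\<close> this orientation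
  makes its diagonals longer, relative to its sides, than those of a Euclidean square.
\<close>

lemma F_transform_lp_growth:
  fixes F :: "real \<Rightarrow> real"
  assumes F: "\<And>x. 0 \<le> x \<Longrightarrow> 0 \<le> F x" "F 0 = 0"
    and p: "1 \<le> p" and "0 < s"
    and K: "\<And>A. finite A \<Longrightarrow> A \<subseteq> lp_space p \<Longrightarrow>
      least_distortion (UNIV :: 'h :: real_inner set) dist A (F_transform F (lp_dist p)) \<le> ereal K"
  shows "0 < F (2 * s)" "F (2 * s) \<le> sqrt 2 * K * F (2 powr recip_exponent p * s)"
proof -
  let ?\<rho> = "F_transform F (lp_dist p)"
  let ?a = "plane_point 0 0" and ?b = "plane_point s s"
  let ?c = "plane_point (2 * s) 0" and ?d = "plane_point s (- s)"
  have sub: "{?a, ?b, ?c, ?d} \<subseteq> lp_space p"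
    by (simp add: plane_point_in_lp_space)
  have "quasi_metric_on (lp_space p) ?\<rho>"
    by (rule quasi_metric_on_F_transform[OF quasi_metric_on_lp]) (use F in auto)
  then have qm: "quasi_metric_on {?a, ?b, ?c, ?d} ?\<rho>"
    using sub unfolding quasi_metric_on_def by blast
  have "?a 0 \<noteq> ?c 0"
    using \<open>0 < s\<close> by (simp add: plane_point_def)
  then have ne: "?a \<noteq> ?c"
    by metis
  have sides: "?\<rho> ?a ?b = F (2 powr recip_exponent p * s)" "?\<rho> ?b ?c = F (2 powr recip_exponent p * s)"
    "?\<rho> ?c ?d = F (2 powr recip_exponent p * s)" "?\<rho> ?d ?a = F (2 powr recip_exponent p * s)"
    using p \<open>0 < s\<close> by (simp_all add: F_transform_def lp_dist_def plane_point_diff lp_norm_bisector)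
  have diagonals: "?\<rho> ?a ?c = F (2 * s)" "?\<rho> ?b ?d = F (2 * s)"
    using p \<open>0 < s\<close> by (simp_all add: F_transform_def lp_dist_def plane_point_diff lp_norm_axis)
  have "least_distortion (UNIV :: 'h set) dist {?a, ?b, ?c, ?d} ?\<rho> \<le> ereal K"
    by (rule K[OF _ sub]) simp
  from diagonal_le_side[OF qm ne sides diagonals this]
  show "0 < F (2 * s)" "F (2 * s) \<le> sqrt 2 * K * F (2 powr recip_exponent p * s)" .
qed

text \<open>
  Going down the scales \<open>\<mu> ^ -n\<close> from \<open>1\<close>, the growth hypothesis keeps the value of \<open>F\<close> at least
  \<open>\<kappa> ^ -n * F 1\<close> and the linear bound makes it at most \<open>C * \<mu> ^ -n\<close>. If \<open>\<kappa>\<close> were smaller than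
  \<open>\<mu>\<close>, these would conflict for large \<open>n\<close>.
\<close>

lemma growth_factor_ge_of_linear_bound:
  fixes F :: "real \<Rightarrow> real"
  assumes "0 < \<mu>" "0 < \<kappa>" "0 < F 1"
    and growth: "\<And>t. 0 < t \<Longrightarrow> F (\<mu> * t) \<le> \<kappa> * F t"
    and linear: "\<And>t. 0 < t \<Longrightarrow> F t \<le> C * t"
  shows "\<mu> \<le> \<kappa>"
proof (rule ccontr)
  assume "\<not> \<mu> \<le> \<kappa>"
  then have less: "\<kappa> / \<mu> < 1"
    using \<open>0 < \<mu>\<close> by simp
  have iterate: "F 1 \<le> \<kappa> ^ n * F (1 / \<mu> ^ n)" for n
  proof (induction n)
    case (Suc n)
    have "F (\<mu> * (1 / \<mu> ^ Suc n)) \<le> \<kappa> * F (1 / \<mu> ^ Suc n)"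
      by (rule growth) (use \<open>0 < \<mu>\<close> in simp)
    then have "F (1 / \<mu> ^ n) \<le> \<kappa> * F (1 / \<mu> ^ Suc n)"
      using \<open>0 < \<mu>\<close> by simp
    then have "\<kappa> ^ n * F (1 / \<mu> ^ n) \<le> \<kappa> ^ n * (\<kappa> * F (1 / \<mu> ^ Suc n))"
      by (rule mult_left_mono) (use \<open>0 < \<kappa>\<close> in simp)
    with Suc show ?case
      by (simp add: mult_ac)
  qed simp
  have "F 1 \<le> C * (\<kappa> / \<mu>) ^ n" for n
  proof -
    note iterate[of n]
    also have "\<kappa> ^ n * F (1 / \<mu> ^ n) \<le> \<kappa> ^ n * (C * (1 / \<mu> ^ n))"
      using linear[of "1 / \<mu> ^ n"] \<open>0 < \<mu>\<close> \<open>0 < \<kappa>\<close> by (intro mult_left_mono) auto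
    finally show ?thesis
      by (simp add: power_divide mult_ac)
  qed
  moreover have "(\<lambda>n. C * (\<kappa> / \<mu>) ^ n) \<longlonglongrightarrow> C * 0"
    using less \<open>0 < \<mu>\<close> \<open>0 < \<kappa>\<close> by (intro tendsto_intros LIMSEQ_power_zero) simp
  ultimately have "F 1 \<le> C * 0"
    by (intro LIMSEQ_le_const) auto
  with \<open>0 < F 1\<close> show False
    by simp
qed

theorem corollary2p1:
  fixes F :: "real \<Rightarrow> real" and p :: ereal and \<epsilon> :: real
  assumes "\<And>x. 0 \<le> x \<Longrightarrow> 0 \<le> F x"
    and "F 0 = 0"
    and "(SUP x\<in>{0<..}. ereal (F x / x)) < \<infinity>"
    and "1 \<le> p"
    and "0 \<le> \<epsilon>" and "\<epsilon> < 1 / 2"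
    and "(SUP A\<in>{A. A \<subseteq> lp_space p \<and> finite A}.
            least_distortion (UNIV :: 'h :: {real_inner, complete_space} set) dist
              A (F_transform F (lp_dist p)))
          \<le> ereal (2 powr \<epsilon>)"
  shows "p \<le> ereal (inverse (1 / 2 - \<epsilon>))"
proof -
  let ?\<theta> = "recip_exponent p"
  have "least_distortion (UNIV :: 'h set) dist A (F_transform F (lp_dist p)) \<le> ereal (2 powr \<epsilon>)"
    if "finite A" "A \<subseteq> lp_space p" for A
    using assms(7) that by (auto simp: SUP_le_iff)
  note growth = F_transform_lp_growth[OF assms(1,2,4) _ this]
  have pos: "0 < F 1"
    using growth(1)[of "1 / 2"] by simp
  have factor: "sqrt 2 * 2 powr \<epsilon> = 2 powr (1 / 2 + \<epsilon>)"
    by (simp add: powr_add powr_half_sqrt)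
  have scale: "F (2 powr (1 - ?\<theta>) * t) \<le> 2 powr (1 / 2 + \<epsilon>) * F t" if "0 < t" for t
    using growth(2)[of "t / 2 powr ?\<theta>"] that by (simp add: factor powr_diff)
  obtain C where C: "(SUP x\<in>{0<..}. ereal (F x / x)) \<le> ereal C"
    using assms(3) by (cases "SUP x\<in>{0<..}. ereal (F x / x)") auto
  have linear: "F t \<le> C * t" if "0 < t" for t
  proof -
    have "ereal (F t / t) \<le> ereal C"
      using C that by (auto simp: SUP_le_iff)
    with that show ?thesis
      by (simp add: pos_divide_le_eq)
  qed
  have "2 powr (1 - ?\<theta>) \<le> 2 powr (1 / 2 + \<epsilon>)"
    by (rule growth_factor_ge_of_linear_bound[OF _ _ pos scale linear]) auto
  then have le: "1 / 2 - \<epsilon> \<le> ?\<theta>"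
    by simp
  show ?thesis
  proof (cases p)
    case (real r)
    with le assms(4,6) show ?thesis
      by (simp add: recip_exponent_def field_simps)
  qed (use le assms(4,6) in \<open>auto simp: recip_exponent_def\<close>)
qed

end
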